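(* For $\mu>0$ let $\varphi_\mu:\mathbb{R}\to\mathbb{R}_{++}$ be defined by $\varphi_\mu(x)=\sqrt{x^2+\mu^2}$, and let $\varphi_0(x)=\sqrt{x^2}$. Then $\varphi_\mu$ converges uniformly to $\varphi_0$ on $\mathbb{R}$ as $\mu\downarrow 0$.
   Context: $\mathbb{R}_{++}=\{x\in\mathbb{R}:x>0\}$. *)

theory Defs
  imports "HOL-Analysis.Analysis"
begin

(* Only used for mu > 0, where it takes values in the positive reals (lemma phi_pos). *)
definition phi :: "real \<Rightarrow> real \<Rightarrow> real" where
  "phi \<mu> x = sqrt (x\<^sup>2 + \<mu>\<^sup>2)"

definition phi0 :: "real \<Rightarrow> real" where
  "phi0 x = sqrt (x\<^sup>2)"

lemma phi_pos: "\<mu> > 0 \<Longrightarrow> phi \<mu> x > 0"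
  by (simp add: phi_def add_nonneg_pos)

end

theory Submission
  imports Defs
begin

text \<open>
  The square root is subadditive, so smoothing the absolute value by \<open>\<mu>\<close> raises it by at most
  \<open>sqrt (\<mu>\<^sup>2) = \<bar>\<mu>\<bar>\<close>, whatever the point \<open>x\<close>. This bound does not depend on \<open>x\<close>, which is exactly
  what makes the convergence uniform on the whole unbounded line: in the definition of uniform
  convergence, any tolerance \<open>e\<close> is met as soon as \<open>0 < \<mu> < e\<close>.
\<close>

lemma dist_phi_phi0_le: "dist (phi \<mu> x) (phi0 x) \<le> \<bar>\<mu>\<bar>"
proof -
  have "phi0 x \<le> phi \<mu> x"
    by (simp add: phi_def phi0_def del: real_sqrt_abs)
  moreover have "phi \<mu> x \<le> phi0 x + \<bar>\<mu>\<bar>"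
    using sqrt_add_le_add_sqrt[of "x\<^sup>2" "\<mu>\<^sup>2"] by (simp add: phi_def phi0_def)
  ultimately show ?thesis
    by (simp add: dist_real_def)
qed

theorem lemma2:
  shows "uniform_limit UNIV phi phi0 (at_right 0)"
proof (rule uniform_limitI)
  fix e :: real
  assume "e > 0"
  then have "\<forall>\<^sub>F \<mu> in at_right 0. \<mu> \<in> {0<..<e}"
    by (rule eventually_at_right_real)
  then show "\<forall>\<^sub>F \<mu> in at_right 0. \<forall>x\<in>UNIV. dist (phi \<mu> x) (phi0 x) < e"
  proof eventually_elim
    case (elim \<mu>)
    then have "\<bar>\<mu>\<bar> < e"
      by simp
    then show ?case
      using dist_phi_phi0_le le_less_trans by blast
  qed
qed

end
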